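(* Let $t\in\mathbb Q$, $t\ne0,\pm1,\pm2$, let $\delta=t^2-4$, and let $p\in\Pi_t$. The sequence group $\bmod\ p$, $\mathcal L_p(t)$, is cyclic; its order is $p-1$ if $\delta$ is a square $\bmod\ p$, and $p+1$ if $\delta$ is not a square $\bmod\ p$.
   Context: For $t\in\mathbb Q$ let $D_t=\begin{pmatrix}0&-1\\1&t\end{pmatrix}$ and let $\mathcal R(t)$ be the commutative ring of all $2\times2$ rational matrices commuting with $D_t$; its elements are the matrices $[x_0\ x_1]:=\begin{pmatrix}x_1-tx_0&-x_0\\ x_0&x_1\end{pmatrix}$, $x_0,x_1\in\mathbb Q$. The sequence group $\mathcal L(t)$ is the commutative group of elements $X\in\mathcal R(t)$ with $\det X\neq0$, modulo multiplication by nonzero rational scalars. Every class has a reduced representative $[x_0\ x_1]$ with $x_0,x_1$ relatively prime integers, unique up to sign. $\Pi_t$ is the set of odd primes not dividing the numerator or the denominator of $t$ or of $\delta=t^2-4$ (as reduced fractions). Rational numbers with denominator prime to $p$ are reduced $\bmod\ p$ in the usual way. For $p\in\Pi_t$ let $\widetilde{\mathcal L_p}(t)\subset\mathcal L(t)$ be the subgroup of classes whose reduced representative has determinant $\ne0\bmod p$. Reduction $\bmod\ p$ of reduced representatives defines a homomorphism $\mathcal M:\widetilde{\mathcal L_p}(t)\to GL(2,\mathbb F_p)/\mathbb F_p^*$, and $\mathcal L_p(t)=\mathcal M(\widetilde{\mathcal L_p}(t))$. *)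

theory Defs
  imports "HOL-Analysis.Analysis" "HOL-Algebra.Elementary_Groups"
    "Berlekamp_Zassenhaus.Finite_Field"
begin

definition D_mat :: "rat \<Rightarrow> rat^2^2" where
  "D_mat t = vector [vector [0, -1], vector [1, t]]"

definition R_ring :: "rat \<Rightarrow> (rat^2^2) set" where
  "R_ring t = {X. X ** D_mat t = D_mat t ** X}"

definition seq_mat :: "rat \<Rightarrow> rat \<Rightarrow> rat \<Rightarrow> rat^2^2" where
  "seq_mat t x0 x1 = vector [vector [x1 - t * x0, - x0], vector [x0, x1]]"

lemma R_ring_eq: "R_ring t = {seq_mat t x0 x1 | x0 x1. True}"
proof -
  have "X \<in> R_ring t \<longleftrightarrow> X = seq_mat t (X$2$1) (X$2$2)" for X
    unfolding R_ring_def D_mat_def seq_mat_def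
    by (auto simp: vec_eq_iff matrix_matrix_mult_def forall_2 sum_2 algebra_simps)
  moreover have "seq_mat t x0 x1 $ 2 $ 1 = x0" "seq_mat t x0 x1 $ 2 $ 2 = x1" for x0 x1
    by (simp_all add: seq_mat_def)
  ultimately show ?thesis by force
qed

text \<open>The library's \<^term>\<open>mat c\<close> is the scalar matrix with \<open>c\<close> on the diagonal, so the
  scalars form a subgroup of the matrix groups below and quotienting by this subgroup is
  working modulo multiplication by nonzero scalars.\<close>

definition scalars :: "('a::field^2^2) set" where
  "scalars = {mat c | c. c \<noteq> 0}"

definition R_units :: "rat \<Rightarrow> (rat^2^2) monoid" where
  "R_units t = \<lparr>carrier = {X \<in> R_ring t. det X \<noteq> 0}, mult = (**), one = mat 1\<rparr>"

definition seq_group :: "rat \<Rightarrow> (rat^2^2) set monoid" where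
  "seq_group t = R_units t Mod scalars"

definition GL2 :: "('a::field^2^2) monoid" where
  "GL2 = \<lparr>carrier = {A. invertible A}, mult = (**), one = mat 1\<rparr>"

definition PGL2 :: "('a::field^2^2) set monoid" where
  "PGL2 = GL2 Mod scalars"

definition Pi_set :: "rat \<Rightarrow> nat set" where
  "Pi_set t = {p. prime p \<and> odd p \<and>
     (\<forall>q \<in> {t, t\<^sup>2 - 4}. \<not> int p dvd fst (quotient_of q) \<and> \<not> int p dvd snd (quotient_of q))}"

text \<open>Elements of a class that are of the form $[x_0\ x_1]$ with coprime integers; by the
  lemmas below they exist and differ only by sign, so the choice is immaterial.\<close>

definition is_reduced_rep :: "rat \<Rightarrow> (rat^2^2) set \<Rightarrow> rat^2^2 \<Rightarrow> bool" where
  "is_reduced_rep t C X \<longleftrightarrow> X \<in> C \<and>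
     (\<exists>x0 x1 :: int. coprime x0 x1 \<and> X = seq_mat t (of_int x0) (of_int x1))"

definition reduced_rep :: "rat \<Rightarrow> (rat^2^2) set \<Rightarrow> rat^2^2" where
  "reduced_rep t C = (SOME X. is_reduced_rep t C X)"

lemma det_seq_mat: "det (seq_mat t x0 x1) = x1\<^sup>2 - t * x0 * x1 + x0\<^sup>2"
  by (simp add: det_2 seq_mat_def power2_eq_square algebra_simps)

lemma mat_mul_seq_mat: "mat c ** seq_mat t x0 x1 = seq_mat t (c * x0) (c * x1)"
  by (simp add: seq_mat_def mat_def vec_eq_iff matrix_matrix_mult_def forall_2 sum_2 algebra_simps)

lemma seq_mat_eq_iff: "seq_mat t x0 x1 = seq_mat t y0 y1 \<longleftrightarrow> x0 = y0 \<and> x1 = y1"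
  by (auto simp: seq_mat_def vec_eq_iff forall_2)

lemma carrier_seq_groupE:
  assumes "C \<in> carrier (seq_group t)"
  obtains a b where "det (seq_mat t a b) \<noteq> 0"
    "C = {seq_mat t (c * a) (c * b) | c. c \<noteq> 0}"
  using assms
  by (force simp: seq_group_def FactGroup_def RCOSETS_def r_coset_def R_units_def R_ring_eq
      scalars_def mat_mul_seq_mat)

lemma reduced_rep_exists:
  assumes "C \<in> carrier (seq_group t)"
  shows "\<exists>X. is_reduced_rep t C X"
proof -
  from assms obtain a b where det: "det (seq_mat t a b) \<noteq> 0"
    and C: "C = {seq_mat t (c * a) (c * b) | c. c \<noteq> 0}"
    by (rule carrier_seq_groupE)
  obtain a1 a2 where a: "quotient_of a = (a1, a2)" by fastforce
  obtain b1 b2 where b: "quotient_of b = (b1, b2)" by fastforce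
  have a': "a = of_int a1 / of_int a2" "a2 > 0" and b': "b = of_int b1 / of_int b2" "b2 > 0"
    using a b by (auto intro: quotient_of_div quotient_of_denom_pos)
  have "a \<noteq> 0 \<or> b \<noteq> 0" using det by (auto simp: det_seq_mat)
  hence nz: "a1 * b2 \<noteq> 0 \<or> b1 * a2 \<noteq> 0" using a' b' by auto
  obtain x y where xy: "a1 * b2 = gcd (a1 * b2) (b1 * a2) * x"
    "b1 * a2 = gcd (a1 * b2) (b1 * a2) * y" "coprime x y"
    using gcd_coprime_exists[of "a1 * b2" "b1 * a2"] nz by (metis gcd_eq_0_iff mult.commute)
  define g where "g = gcd (a1 * b2) (b1 * a2)"
  have g: "g \<noteq> 0" using nz by (auto simp: g_def)
  define c :: rat where "c = of_int (a2 * b2) / of_int g"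
  have "c \<noteq> 0" using a' b' g by (simp add: c_def)
  moreover have "rat_of_int a1 * of_int b2 = of_int g * of_int x"
    "rat_of_int b1 * of_int a2 = of_int g * of_int y"
    using xy(1,2) unfolding g_def by (metis of_int_mult)+
  moreover have "c * a = rat_of_int a1 * of_int b2 / of_int g"
    "c * b = rat_of_int b1 * of_int a2 / of_int g"
    using a' b' by (simp_all add: c_def)
  ultimately have "c \<noteq> 0" "of_int x = c * a" "of_int y = c * b"
    using g by simp_all
  then show ?thesis
    unfolding is_reduced_rep_def C using xy(3) by (metis (mono_tags, lifting) mem_Collect_eq)
qed

lemma reduced_rep_unique:
  assumes "C \<in> carrier (seq_group t)" "is_reduced_rep t C X" "is_reduced_rep t C Y"
  shows "Y = X \<or> Y = - X"
proof -
  from assms(1) obtain a b where C: "C = {seq_mat t (c * a) (c * b) | c. c \<noteq> 0}"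
    by (rule carrier_seq_groupE)
  from assms(2) obtain x0 x1 :: int where x: "coprime x0 x1" "X = seq_mat t (of_int x0) (of_int x1)"
    "X \<in> C" by (auto simp: is_reduced_rep_def)
  from assms(3) obtain y0 y1 :: int where y: "coprime y0 y1" "Y = seq_mat t (of_int y0) (of_int y1)"
    "Y \<in> C" by (auto simp: is_reduced_rep_def)
  obtain c where c: "c \<noteq> 0" "of_int x0 = c * a" "of_int x1 = c * b"
    using x(2,3) C by (auto simp: seq_mat_eq_iff)
  obtain d where d: "d \<noteq> 0" "of_int y0 = d * a" "of_int y1 = d * b"
    using y(2,3) C by (auto simp: seq_mat_eq_iff)
  have "rat_of_int (x0 * y1) = of_int (x1 * y0)" using c d by simp
  hence cross: "x0 * y1 = x1 * y0" by (simp only: of_int_eq_iff)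
  have "x0 dvd x1 * y0" "y0 dvd y1 * x0" "x1 dvd x0 * y1" "y1 dvd y0 * x1"
    using cross by (metis dvd_triv_left mult.commute)+
  hence "x0 dvd y0" "y0 dvd x0" "x1 dvd y1" "y1 dvd x1"
    using x(1) y(1) by (simp_all add: coprime_dvd_mult_right_iff coprime_commute)
  hence abs: "\<bar>x0\<bar> = \<bar>y0\<bar>" "\<bar>x1\<bar> = \<bar>y1\<bar>"
    by (blast intro: zdvd_antisym_abs)+
  have "(y0 = x0 \<and> y1 = x1) \<or> (y0 = - x0 \<and> y1 = - x1)"
    using abs cross by (auto simp: abs_eq_iff)
  thus ?thesis
    unfolding x(2) y(2) by (auto simp: seq_mat_def vec_eq_iff forall_2)
qed

text \<open>Here \<^typ>\<open>'p mod_ring\<close> is the field with \<open>p = CARD('p)\<close> elements, and the reduction is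
  meaningful for rational numbers whose denominator is prime to \<open>p\<close>.\<close>

definition red :: "rat \<Rightarrow> 'p::prime_card mod_ring" where
  "red q = of_int (fst (quotient_of q)) / of_int (snd (quotient_of q))"

definition red_mat :: "rat^2^2 \<Rightarrow> ('p::prime_card mod_ring)^2^2" where
  "red_mat X = (\<chi> i j. red (X $ i $ j))"

definition seq_group_tilde :: "'p::prime_card itself \<Rightarrow> rat \<Rightarrow> (rat^2^2) set set" where
  "seq_group_tilde _ t =
     {C \<in> carrier (seq_group t). (red (det (reduced_rep t C)) :: 'p mod_ring) \<noteq> 0}"

definition M_hom :: "rat \<Rightarrow> (rat^2^2) set \<Rightarrow> ('p::prime_card mod_ring^2^2) set" where
  "M_hom t C = scalars #>\<^bsub>GL2\<^esub> red_mat (reduced_rep t C)"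

definition seq_group_mod :: "'p::prime_card itself \<Rightarrow> rat \<Rightarrow> ('p mod_ring^2^2) set monoid" where
  "seq_group_mod _ t = PGL2\<lparr>carrier := M_hom t ` seq_group_tilde TYPE('p) t\<rparr>"

end

theory Submission
  imports Defs
begin

text \<open>
  Write \<open>S a b\<close> for the matrix \<open>[a b]\<close> over an arbitrary field, with parameter \<open>\<tau>\<close> in place of
  \<open>t\<close>. It equals \<open>b + a (D - \<tau>)\<close>, so these matrices form the algebra generated by the companion
  matrix \<open>D\<close> of \<open>z\<^sup>2 - \<tau> z + 1\<close>, and \<open>det (S a b) = b\<^sup>2 - \<tau> a b + a\<^sup>2\<close> is its norm form. Everything is
  governed by whether the polynomial splits, that is, outside characteristic two, by whether its
  discriminant \<open>\<tau>\<^sup>2 - 4\<close> is a square.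

  \<^item> The first point is that the sequence group mod \<open>p\<close> is the whole quotient of the invertible
  matrices \<open>S a b\<close> over the prime field by the scalars, for \<open>\<tau>\<close> the residue of \<open>t\<close>
  (\<open>seq_group_mod_eq_quotient\<close>). Only surjectivity needs an argument: a nonzero pair of residues
  lifts to integers, and dividing these by their greatest common divisor, which is prime to \<open>p\<close>,
  changes the matrix by a scalar.

  \<^item> If \<open>\<tau>\<^sup>2 - 4\<close> is a nonzero square, then, as \<open>2\<close> is invertible, the polynomial has
  distinct roots \<open>\<alpha>\<close> and \<open>\<beta>\<close>. Then
  \<open>S a b \<mapsto> b - \<alpha> a\<close> and \<open>S a b \<mapsto> b - \<beta> a\<close> are the two eigenvalue characters of the algebra, and
  their quotient is a homomorphism onto the multiplicative group of the field whose kernel consists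
  of the scalars. The group is thus isomorphic to the multiplicative group of the field
  (\<open>quotient_iso_mult_group\<close>).

  \<^item> If \<open>\<tau>\<^sup>2 - 4\<close> is not a square, the norm form is anisotropic, so the algebra is a field with
  \<open>p\<^sup>2\<close> elements (\<open>companion_ring_field\<close>). Its multiplicative group is cyclic of order \<open>p\<^sup>2 - 1\<close>, and
  the quotient by the \<open>p - 1\<close> scalars is cyclic of order \<open>p + 1\<close>.
\<close>

section \<open>The algebra generated by a companion matrix\<close>

definition companion_mat :: "'a::field \<Rightarrow> 'a \<Rightarrow> 'a \<Rightarrow> 'a^2^2" where
  "companion_mat \<tau> a b = vector [vector [b - \<tau> * a, - a], vector [a, b]]"

lemma companion_mat_eq_iff [simp]:
  "companion_mat \<tau> a b = companion_mat \<tau> c d \<longleftrightarrow> a = c \<and> b = d"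
  by (auto simp: companion_mat_def vec_eq_iff forall_2)

lemma det_companion_mat: "det (companion_mat \<tau> a b) = b\<^sup>2 - \<tau> * a * b + a\<^sup>2"
  by (simp add: det_2 companion_mat_def power2_eq_square algebra_simps)

lemma companion_mat_mult:
  "companion_mat \<tau> a b ** companion_mat \<tau> c d = companion_mat \<tau> (a * d + b * c - \<tau> * a * c) (b * d - a * c)"
  by (simp add: companion_mat_def vec_eq_iff matrix_matrix_mult_def forall_2 sum_2 algebra_simps)

lemma companion_mat_add:
  "companion_mat \<tau> a b + companion_mat \<tau> c d = companion_mat \<tau> (a + c) (b + d)"
  by (simp add: companion_mat_def vec_eq_iff forall_2 algebra_simps)

lemma mat_eq_companion_mat: "mat c = companion_mat \<tau> 0 c"
  by (simp add: companion_mat_def mat_def vec_eq_iff forall_2)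

lemma zero_eq_companion_mat: "0 = companion_mat \<tau> 0 0"
  by (simp add: companion_mat_def vec_eq_iff forall_2)

lemma companion_mat_scaled:
  "companion_mat \<tau> (c * a) (c * b) = mat c ** companion_mat \<tau> a b"
  by (simp add: mat_eq_companion_mat[of c \<tau>] companion_mat_mult)

definition companion_units :: "'a::field \<Rightarrow> ('a^2^2) monoid" where
  "companion_units \<tau> =
     GL2\<lparr>carrier := {companion_mat \<tau> a b | a b. det (companion_mat \<tau> a b) \<noteq> 0}\<rparr>"

lemma companion_units_simps [simp]:
  "carrier (companion_units \<tau>) = {companion_mat \<tau> a b | a b. det (companion_mat \<tau> a b) \<noteq> 0}"
  "mult (companion_units \<tau>) = (**)"
  "one (companion_units \<tau>) = mat 1"
  by (simp_all add: companion_units_def GL2_def)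

text \<open>The inverse of \<open>S a b\<close> is its conjugate \<open>S (- a) (b - \<tau> a)\<close> divided by the norm.\<close>

lemma companion_mat_inverse:
  assumes "det (companion_mat \<tau> a b) \<noteq> 0"
  defines "n \<equiv> det (companion_mat \<tau> a b)"
  shows "companion_mat \<tau> (- a / n) ((b - \<tau> * a) / n) ** companion_mat \<tau> a b = mat 1"
proof -
  have n: "n = b\<^sup>2 - \<tau> * a * b + a\<^sup>2" "n \<noteq> 0"
    using assms by (simp_all add: det_companion_mat)
  have "- a / n * b + (b - \<tau> * a) / n * a - \<tau> * (- a / n) * a = 0"
    using n(2) by (simp add: field_simps)
  moreover have "(b - \<tau> * a) / n * b - (- a / n) * a = (b\<^sup>2 - \<tau> * a * b + a\<^sup>2) / n"
    using n(2) by (simp add: field_simps power2_eq_square)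
  then have "(b - \<tau> * a) / n * b - (- a / n) * a = 1"
    using n by simp
  ultimately show ?thesis
    by (simp only: companion_mat_mult mat_eq_companion_mat[of 1 \<tau>])
qed

lemma companion_mat_mult_commute:
  "companion_mat \<tau> a b ** companion_mat \<tau> c d = companion_mat \<tau> c d ** companion_mat \<tau> a b"
  by (simp add: companion_mat_mult algebra_simps)

lemma comm_group_companion_units: "comm_group (companion_units \<tau>)"
proof (rule comm_groupI)
  fix X Y assume X: "X \<in> carrier (companion_units \<tau>)" and Y: "Y \<in> carrier (companion_units \<tau>)"
  then show "X \<otimes>\<^bsub>companion_units \<tau>\<^esub> Y = Y \<otimes>\<^bsub>companion_units \<tau>\<^esub> X"
    using companion_mat_mult_commute by auto
  from X Y obtain a b c d where XY: "X = companion_mat \<tau> a b" "Y = companion_mat \<tau> c d"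
    and "det X \<noteq> 0" "det Y \<noteq> 0"
    by auto
  then have "det (X ** Y) \<noteq> 0"
    by (simp add: det_mul)
  then show "X \<otimes>\<^bsub>companion_units \<tau>\<^esub> Y \<in> carrier (companion_units \<tau>)"
    unfolding XY by (auto simp: companion_mat_mult)
next
  show "\<one>\<^bsub>companion_units \<tau>\<^esub> \<in> carrier (companion_units \<tau>)"
    by (auto simp: mat_eq_companion_mat[of 1 \<tau>] det_companion_mat)
next
  fix X assume "X \<in> carrier (companion_units \<tau>)"
  then obtain a b where X: "X = companion_mat \<tau> a b" "det X \<noteq> 0"
    by auto
  define n where "n = det X"
  define Y where "Y = companion_mat \<tau> (- a / n) ((b - \<tau> * a) / n)"
  have inv: "Y ** X = mat 1"
    using companion_mat_inverse[of \<tau> a b] X by (simp add: Y_def n_def)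
  then have "det Y * det X = 1"
    by (metis det_I det_mul)
  then have "Y \<in> carrier (companion_units \<tau>)"
    by (auto simp: Y_def)
  with inv show "\<exists>Y\<in>carrier (companion_units \<tau>). Y \<otimes>\<^bsub>companion_units \<tau>\<^esub> X = \<one>\<^bsub>companion_units \<tau>\<^esub>"
    by (intro bexI[of _ Y]) simp_all
qed (auto simp: matrix_mul_assoc)

lemma mat_in_scalars: "c \<noteq> 0 \<Longrightarrow> mat c \<in> scalars"
  unfolding scalars_def by (intro CollectI exI[of _ c]) simp

lemma subgroup_scalars: "subgroup scalars (companion_units \<tau>)"
proof -
  interpret comm_group "companion_units \<tau>"
    by (rule comm_group_companion_units)
  have sub: "scalars \<subseteq> carrier (companion_units \<tau>)"
  proof
    fix X :: "'a^2^2" assume "X \<in> scalars"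
    then obtain c where "X = companion_mat \<tau> 0 c" "c \<noteq> 0"
      by (auto simp: scalars_def mat_eq_companion_mat[of _ \<tau>])
    then show "X \<in> carrier (companion_units \<tau>)"
      by (auto simp: det_companion_mat)
  qed
  show ?thesis
  proof (rule subgroupI)
    show "scalars \<noteq> ({} :: ('a^2^2) set)"
      using mat_in_scalars[of 1] by auto
    fix X Y :: "'a^2^2" assume "X \<in> scalars" "Y \<in> scalars"
    then obtain c d where cd: "X = mat c" "c \<noteq> 0" "Y = mat d" "d \<noteq> 0"
      by (auto simp: scalars_def)
    then have "X \<otimes>\<^bsub>companion_units \<tau>\<^esub> Y = mat (c * d)"
      by (simp add: mat_eq_companion_mat[of _ \<tau>] companion_mat_mult)
    then show "X \<otimes>\<^bsub>companion_units \<tau>\<^esub> Y \<in> scalars"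
      using cd by (simp add: mat_in_scalars)
  next
    fix X :: "'a^2^2" assume X: "X \<in> scalars"
    then obtain c where c: "X = mat c" "c \<noteq> 0"
      by (auto simp: scalars_def)
    have "mat (1 / c) ** X = mat 1"
      using c by (simp add: mat_eq_companion_mat[of _ \<tau>] companion_mat_mult)
    moreover have inv: "mat (1 / c) \<in> (scalars :: ('a^2^2) set)"
      using c by (simp add: mat_in_scalars)
    ultimately have "inv\<^bsub>companion_units \<tau>\<^esub> X = mat (1 / c)"
      using X sub by (intro inv_equality) auto
    with inv show "inv\<^bsub>companion_units \<tau>\<^esub> X \<in> scalars"
      by simp
  qed (rule sub)
qed

lemma group_companion_quotient: "group (companion_units \<tau> Mod scalars)"
  using comm_group.abelian_FactGroup[OF comm_group_companion_units subgroup_scalars]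
  by (rule comm_group.axioms)

lemma card_scalars: "card (scalars :: ('a::{field,finite}^2^2) set) = CARD('a) - 1"
proof -
  have eq: "scalars = (mat :: 'a \<Rightarrow> 'a^2^2) ` (UNIV - {0})"
    by (auto simp: scalars_def)
  have "inj (mat :: 'a \<Rightarrow> 'a^2^2)"
    by (rule injI) (simp add: mat_eq_companion_mat[of _ 0])
  then have "inj_on (mat :: 'a \<Rightarrow> 'a^2^2) (UNIV - {0})"
    by (rule inj_on_subset) simp
  then have "card (scalars :: ('a^2^2) set) = card (UNIV - {0 :: 'a})"
    unfolding eq by (rule card_image)
  then show ?thesis
    by (simp add: card_Diff_singleton)
qed

lemma coset_scaled_companion_mat:
  assumes "c \<noteq> 0"
  shows "scalars #>\<^bsub>GL2\<^esub> companion_mat \<tau> (c * a) (c * b) = scalars #>\<^bsub>GL2\<^esub> companion_mat \<tau> a b"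
proof -
  have eq: "scalars #>\<^bsub>GL2\<^esub> companion_mat \<tau> a b = {companion_mat \<tau> (k * a) (k * b) | k. k \<noteq> 0}" for a b :: 'a
    by (auto simp: r_coset_def GL2_def scalars_def companion_mat_scaled)
  show ?thesis
    unfolding eq
  proof (intro equalityI subsetI)
    fix X assume "X \<in> {companion_mat \<tau> (k * (c * a)) (k * (c * b)) | k. k \<noteq> 0}"
    then obtain k where "k \<noteq> 0" "X = companion_mat \<tau> ((k * c) * a) ((k * c) * b)"
      by (auto simp: mult.assoc)
    with assms show "X \<in> {companion_mat \<tau> (k * a) (k * b) | k. k \<noteq> 0}"
      using mult_eq_0_iff by blast
  next
    fix X assume "X \<in> {companion_mat \<tau> (k * a) (k * b) | k. k \<noteq> 0}"
    then obtain k where "k \<noteq> 0" "X = companion_mat \<tau> ((k / c) * (c * a)) ((k / c) * (c * b))"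
      using assms by auto
    with assms show "X \<in> {companion_mat \<tau> (k * (c * a)) (k * (c * b)) | k. k \<noteq> 0}"
      using divide_eq_0_iff by blast
  qed
qed

section \<open>The structure of the quotient by the scalars\<close>

lemma (in field) cyclic_mult_group:
  assumes "finite (carrier R)"
  shows "cyclic_group (mult_of R)"
proof -
  interpret G: group "mult_of R"
    by (rule field_mult_group)
  obtain a where a: "a \<in> carrier (mult_of R)"
    and gen: "carrier (mult_of R) = {a [^] i | i::nat. i \<in> UNIV}"
    using finite_field_mult_group_has_gen[OF assms] by blast
  have "carrier (mult_of R) \<subseteq> range (\<lambda>n::int. a [^]\<^bsub>mult_of R\<^esub> n)"
  proof
    fix x assume "x \<in> carrier (mult_of R)"
    then obtain i :: nat where "x = a [^] i"
      unfolding gen by blast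
    then have "x = a [^]\<^bsub>mult_of R\<^esub> int i"
      by (simp add: int_pow_int nat_pow_mult_of)
    then show "x \<in> range (\<lambda>n::int. a [^]\<^bsub>mult_of R\<^esub> n)"
      by blast
  qed
  moreover have "range (\<lambda>n::int. a [^]\<^bsub>mult_of R\<^esub> n) \<subseteq> carrier (mult_of R)"
    using a G.int_pow_closed by blast
  ultimately show ?thesis
    using a unfolding G.cyclic_group by blast
qed

text \<open>A field type as a structure with explicit carrier, so that theorems about such structures
  apply to it.\<close>

definition type_ring :: "'a::field ring" where
  "type_ring = \<lparr>carrier = UNIV, mult = (*), one = 1, zero = 0, add = (+)\<rparr>"

lemma field_type_ring: "field (type_ring :: 'a::field ring)"
proof -
  have "cring (type_ring :: 'a ring)"
    by (intro cringI abelian_groupI comm_monoidI)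
      (auto simp: type_ring_def algebra_simps intro: exI[of _ "- x" for x])
  then show ?thesis
  proof (rule cring.cring_fieldI2)
    fix x :: 'a assume "x \<noteq> \<zero>\<^bsub>type_ring\<^esub>"
    then show "\<exists>y\<in>carrier type_ring. x \<otimes>\<^bsub>type_ring\<^esub> y = \<one>\<^bsub>type_ring\<^esub>"
      by (intro bexI[of _ "inverse x"]) (simp_all add: type_ring_def)
  qed (simp add: type_ring_def)
qed

text \<open>For a root \<open>\<alpha>\<close> of \<open>z\<^sup>2 - \<tau> z + 1\<close>, the other root is \<open>\<tau> - \<alpha>\<close>, and \<open>b - \<alpha> a\<close> is the eigenvalue
  of \<open>S a b\<close> on the eigenvector of \<open>D\<close> for \<open>\<tau> - \<alpha>\<close>; on a common eigenvector eigenvalues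
  multiply.\<close>

lemma eigenvalue_mult:
  fixes \<alpha> :: "'a::field"
  assumes "\<alpha>\<^sup>2 - \<tau> * \<alpha> + 1 = 0"
  shows "(b * d - a * c) - \<alpha> * (a * d + b * c - \<tau> * a * c) = (b - \<alpha> * a) * (d - \<alpha> * c)"
proof -
  have "(b - \<alpha> * a) * (d - \<alpha> * c) - ((b * d - a * c) - \<alpha> * (a * d + b * c - \<tau> * a * c))
      = a * c * (\<alpha>\<^sup>2 - \<tau> * \<alpha> + 1)"
    by (simp add: algebra_simps power2_eq_square)
  then show ?thesis
    using assms by simp
qed

text \<open>The ratio of the two eigenvalues is invariant under scaling, and it is \<open>1\<close> exactly when the
  matrix is scalar; every nonzero ratio occurs because the eigenvalues can be prescribed
  independently.\<close>

lemma quotient_iso_mult_group: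
  fixes \<alpha> \<beta> :: "'a::field"
  assumes \<tau>: "\<tau> = \<alpha> + \<beta>" and prod: "\<alpha> * \<beta> = 1" and "\<alpha> \<noteq> \<beta>"
  shows "companion_units \<tau> Mod scalars \<cong> mult_of (type_ring :: 'a ring)"
proof -
  define h :: "'a^2^2 \<Rightarrow> 'a" where
    "h X = (X$2$2 - \<alpha> * X$2$1) / (X$2$2 - \<beta> * X$2$1)" for X
  have h: "h (companion_mat \<tau> a b) = (b - \<alpha> * a) / (b - \<beta> * a)" for a b
    by (simp add: h_def companion_mat_def)
  have det: "det (companion_mat \<tau> a b) = (b - \<alpha> * a) * (b - \<beta> * a)" for a b
  proof -
    have "(b - \<alpha> * a) * (b - \<beta> * a) = b\<^sup>2 - (\<alpha> + \<beta>) * a * b + (\<alpha> * \<beta>) * a\<^sup>2"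
      by (simp add: algebra_simps power2_eq_square)
    then show ?thesis
      by (simp add: det_companion_mat \<tau> prod)
  qed
  have roots: "\<alpha>\<^sup>2 - \<tau> * \<alpha> + 1 = 0" "\<beta>\<^sup>2 - \<tau> * \<beta> + 1 = 0"
    unfolding \<tau> prod[symmetric] by (simp_all add: algebra_simps power2_eq_square)
  let ?F = "mult_of (type_ring :: 'a ring)"
  interpret F: field "type_ring :: 'a ring"
    by (rule field_type_ring)
  interpret G: comm_group "companion_units \<tau>"
    by (rule comm_group_companion_units)
  have "h \<in> hom (companion_units \<tau>) ?F"
  proof (rule homI)
    fix X assume "X \<in> carrier (companion_units \<tau>)"
    then show "h X \<in> carrier ?F"
      by (auto simp: type_ring_def h det)
  next
    fix X Y assume "X \<in> carrier (companion_units \<tau>)" "Y \<in> carrier (companion_units \<tau>)"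
    then show "h (X \<otimes>\<^bsub>companion_units \<tau>\<^esub> Y) = h X \<otimes>\<^bsub>?F\<^esub> h Y"
      by (auto simp: type_ring_def h companion_mat_mult eigenvalue_mult[OF roots(1)] eigenvalue_mult[OF roots(2)])
  qed
  then interpret h: group_hom "companion_units \<tau>" ?F h
    by (intro group_hom.intro group_hom_axioms.intro G.is_group F.field_mult_group)
  have ker: "kernel (companion_units \<tau>) ?F h = scalars"
  proof (intro equalityI subsetI)
    fix X assume "X \<in> kernel (companion_units \<tau>) ?F h"
    then obtain a b where X: "X = companion_mat \<tau> a b" and nz: "b - \<alpha> * a \<noteq> 0" "b - \<beta> * a \<noteq> 0"
      and "h X = 1"
      by (auto simp: kernel_def type_ring_def det)
    then have "\<alpha> * a = \<beta> * a"
      by (simp add: h)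
    then have "a = 0"
      using \<open>\<alpha> \<noteq> \<beta>\<close> by simp
    then show "X \<in> scalars"
      using X nz mat_in_scalars[of b] by (simp add: mat_eq_companion_mat[of _ \<tau>])
  next
    fix X :: "'a^2^2" assume "X \<in> scalars"
    then obtain c where "X = companion_mat \<tau> 0 c" "c \<noteq> 0"
      by (auto simp: scalars_def mat_eq_companion_mat[of _ \<tau>])
    then show "X \<in> kernel (companion_units \<tau>) ?F h"
      by (auto simp: kernel_def type_ring_def det h)
  qed
  have "h ` carrier (companion_units \<tau>) = carrier ?F"
  proof (intro equalityI subsetI)
    fix u assume "u \<in> carrier ?F"
    then have u: "u \<noteq> 0"
      by (simp add: type_ring_def)
    \<comment> \<open>the matrix with eigenvalues \<open>u\<close> and \<open>1\<close>\<close>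
    define a where "a = (1 - u) / (\<alpha> - \<beta>)"
    define b where "b = 1 + \<beta> * a"
    have "(\<alpha> - \<beta>) * a = 1 - u"
      using \<open>\<alpha> \<noteq> \<beta>\<close> by (simp add: a_def)
    then have "b - \<alpha> * a = u" "b - \<beta> * a = 1"
      by (simp_all add: b_def algebra_simps)
    then have "companion_mat \<tau> a b \<in> carrier (companion_units \<tau>)" "h (companion_mat \<tau> a b) = u"
      using u by (auto simp: h det)
    then show "u \<in> h ` carrier (companion_units \<tau>)"
      by (metis imageI)
  qed (use h.hom_closed in blast)
  then show ?thesis
    using h.FactGroup_iso_set unfolding ker is_iso_def by blast
qed

definition companion_ring :: "'a::field \<Rightarrow> ('a^2^2) ring" where
  "companion_ring \<tau> =
     \<lparr>carrier = {companion_mat \<tau> a b | a b. True}, mult = (**), one = mat 1, zero = 0, add = (+)\<rparr>"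

text \<open>Completing the square, \<open>4 det (S a b) = (2 b - \<tau> a)\<^sup>2 - (\<tau>\<^sup>2 - 4) a\<^sup>2\<close>, so a nontrivial zero of
  the norm form would exhibit \<open>\<tau>\<^sup>2 - 4\<close> as a square.\<close>

lemma det_companion_mat_anisotropic:
  fixes \<tau> :: "'a::field"
  assumes nonsq: "\<nexists>y. y\<^sup>2 = \<tau>\<^sup>2 - 4"
  shows "det (companion_mat \<tau> a b) = 0 \<longleftrightarrow> a = 0 \<and> b = 0"
proof
  assume "det (companion_mat \<tau> a b) = 0"
  then have 0: "b\<^sup>2 - \<tau> * a * b + a\<^sup>2 = 0"
    by (simp add: det_companion_mat)
  have "(2 * b - \<tau> * a)\<^sup>2 - (\<tau>\<^sup>2 - 4) * a\<^sup>2 = 4 * (b\<^sup>2 - \<tau> * a * b + a\<^sup>2)"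
    by (simp add: algebra_simps power2_eq_square)
  then have "(2 * b - \<tau> * a)\<^sup>2 = (\<tau>\<^sup>2 - 4) * a\<^sup>2"
    using 0 by simp
  then have "a \<noteq> 0 \<Longrightarrow> ((2 * b - \<tau> * a) / a)\<^sup>2 = \<tau>\<^sup>2 - 4"
    by (simp add: power_divide)
  then have "a = 0"
    using nonsq by blast
  then show "a = 0 \<and> b = 0"
    using 0 by simp
qed (simp add: det_companion_mat)

lemma companion_ring_field:
  fixes \<tau> :: "'a::field"
  assumes "\<nexists>y. y\<^sup>2 = \<tau>\<^sup>2 - 4"
  shows "field (companion_ring \<tau>)"
proof -
  have closed: "\<exists>a b. X = companion_mat \<tau> a b \<Longrightarrow> \<exists>a b. Y = companion_mat \<tau> a b \<Longrightarrow>
      (\<exists>a b. X ** Y = companion_mat \<tau> a b) \<and> (\<exists>a b. X + Y = companion_mat \<tau> a b)" for X Y :: "'a^2^2"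
    by (metis companion_mat_mult companion_mat_add)
  have neg: "companion_mat \<tau> (- a) (- b) + companion_mat \<tau> a b = 0" for a b
    by (simp add: companion_mat_add zero_eq_companion_mat[of \<tau>])
  have "abelian_group (companion_ring \<tau>)"
  proof (rule abelian_groupI)
    fix X assume "X \<in> carrier (companion_ring \<tau>)"
    then show "\<exists>Y\<in>carrier (companion_ring \<tau>). Y \<oplus>\<^bsub>companion_ring \<tau>\<^esub> X = \<zero>\<^bsub>companion_ring \<tau>\<^esub>"
      using neg by (fastforce simp: companion_ring_def)
  qed (use closed zero_eq_companion_mat in \<open>fastforce simp: companion_ring_def algebra_simps\<close>)+
  moreover have "comm_monoid (companion_ring \<tau>)"
    by (rule comm_monoidI)
      (use closed mat_eq_companion_mat companion_mat_mult_commute in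
        \<open>fastforce simp: companion_ring_def matrix_mul_assoc\<close>)+
  ultimately have "cring (companion_ring \<tau>)"
    by (rule cringI)
      (simp add: companion_ring_def matrix_matrix_mult_def vec_eq_iff sum.distrib distrib_right)
  then show ?thesis
  proof (rule cring.cring_fieldI2)
    show "\<zero>\<^bsub>companion_ring \<tau>\<^esub> \<noteq> \<one>\<^bsub>companion_ring \<tau>\<^esub>"
      by (simp add: companion_ring_def zero_eq_companion_mat[of \<tau>] mat_eq_companion_mat[of _ \<tau>])
    fix X assume "X \<in> carrier (companion_ring \<tau>)" "X \<noteq> \<zero>\<^bsub>companion_ring \<tau>\<^esub>"
    then obtain a b where X: "X = companion_mat \<tau> a b" "det X \<noteq> 0"
      using det_companion_mat_anisotropic[OF assms]
      by (auto simp: companion_ring_def zero_eq_companion_mat[of \<tau>])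
    then obtain c d where "companion_mat \<tau> c d ** X = mat 1"
      using companion_mat_inverse by metis
    then have "X ** companion_mat \<tau> c d = mat 1"
      using X companion_mat_mult_commute by metis
    then show "\<exists>Y\<in>carrier (companion_ring \<tau>). X \<otimes>\<^bsub>companion_ring \<tau>\<^esub> Y = \<one>\<^bsub>companion_ring \<tau>\<^esub>"
      by (auto simp: companion_ring_def)
  qed
qed

text \<open>Anisotropy identifies the matrices of nonzero determinant with the nonzero elements.\<close>

lemma companion_units_eq_mult_of:
  fixes \<tau> :: "'a::field"
  assumes "\<nexists>y. y\<^sup>2 = \<tau>\<^sup>2 - 4"
  shows "companion_units \<tau> = mult_of (companion_ring \<tau>)"
  using det_companion_mat_anisotropic[OF assms]
  by (auto simp: companion_units_def GL2_def mult_of_def companion_ring_def zero_eq_companion_mat[of \<tau>])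

lemma companion_quotient_nonsquare:
  fixes \<tau> :: "'a::{field,finite}"
  assumes "\<nexists>y. y\<^sup>2 = \<tau>\<^sup>2 - 4"
  shows "cyclic_group (companion_units \<tau> Mod scalars)"
    and "order (companion_units \<tau> Mod scalars) = CARD('a) + 1"
proof -
  interpret K: field "companion_ring \<tau>"
    by (rule companion_ring_field[OF assms])
  interpret G: comm_group "companion_units \<tau>"
    by (rule comm_group_companion_units)
  interpret N: normal scalars "companion_units \<tau>"
    by (rule G.subgroup_imp_normal[OF subgroup_scalars])
  have "cyclic_group (companion_units \<tau>)"
    using K.cyclic_mult_group by (simp add: companion_units_eq_mult_of[OF assms])
  moreover have "(\<lambda>X. scalars #>\<^bsub>companion_units \<tau>\<^esub> X) \<in> epi (companion_units \<tau>) (companion_units \<tau> Mod scalars)"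
    using N.r_coset_hom_Mod by (auto simp: epi_def carrier_FactGroup)
  ultimately show "cyclic_group (companion_units \<tau> Mod scalars)"
    using G.cyclic_group_epimorphic_image group_companion_quotient by blast
  have "carrier (companion_ring \<tau>) = (\<lambda>(a, b). companion_mat \<tau> a b) ` UNIV"
    by (auto simp: companion_ring_def)
  moreover have "inj (\<lambda>(a, b). companion_mat \<tau> a b)"
    by (auto simp: inj_def)
  ultimately have "card (carrier (companion_ring \<tau>)) = CARD('a \<times> 'a)"
    by (simp add: card_image)
  then have "order (companion_units \<tau>) = CARD('a) * CARD('a) - 1"
    by (simp add: companion_units_eq_mult_of[OF assms] K.order_mult_of order_def)
  then have "card (rcosets\<^bsub>companion_units \<tau>\<^esub> scalars) * (CARD('a) - 1) = CARD('a) * CARD('a) - 1"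
    using G.lagrange[OF subgroup_scalars] by (simp add: card_scalars)
  also have "\<dots> = (CARD('a) + 1) * (CARD('a) - 1)"
    by (simp add: algebra_simps)
  finally have "card (rcosets\<^bsub>companion_units \<tau>\<^esub> scalars) * (CARD('a) - 1) =
      (CARD('a) + 1) * (CARD('a) - 1)" .
  moreover have "CARD('a) - 1 \<noteq> 0"
    using card_mono[of UNIV "{0, 1 :: 'a}"] by simp
  ultimately show "order (companion_units \<tau> Mod scalars) = CARD('a) + 1"
    by (simp only: order_def FactGroup_def partial_object.simps mult_cancel2 simp_thms)
qed

lemma companion_quotient_square:
  fixes \<tau> :: "'a::{field,finite}"
  assumes y: "y\<^sup>2 = \<tau>\<^sup>2 - 4" and "\<tau>\<^sup>2 - 4 \<noteq> 0" and two: "(2 :: 'a) \<noteq> 0"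
  shows "cyclic_group (companion_units \<tau> Mod scalars)"
    and "order (companion_units \<tau> Mod scalars) = CARD('a) - 1"
proof -
  define \<alpha> where "\<alpha> = (\<tau> + y) / 2"
  define \<beta> where "\<beta> = (\<tau> - y) / 2"
  have "y \<noteq> 0"
    using assms by auto
  \<comment> \<open>all identities for the roots are first multiplied by powers of \<open>2\<close> to clear denominators\<close>
  have double: "2 * \<alpha> = \<tau> + y" "2 * \<beta> = \<tau> - y"
    using two by (simp_all add: \<alpha>_def \<beta>_def)
  have "2 * (\<alpha> + \<beta>) = 2 * \<tau>" "2 * (\<alpha> - \<beta>) = 2 * y"
    unfolding distrib_left right_diff_distrib double by simp_all
  then have "\<alpha> + \<beta> = \<tau>" "\<alpha> - \<beta> = y"
    using two by (simp_all only: mult_cancel_left simp_thms)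
  moreover have "\<alpha> * \<beta> = 1"
  proof -
    have "2 * 2 * (\<alpha> * \<beta>) = (2 * \<alpha>) * (2 * \<beta>)"
      by (simp add: ac_simps)
    also have "\<dots> = \<tau>\<^sup>2 - y\<^sup>2"
      unfolding double by (simp add: algebra_simps power2_eq_square)
    also have "\<dots> = 2 * 2 * 1"
      by (simp add: y)
    finally show ?thesis
      using two by (simp only: mult_cancel_left mult_eq_0_iff simp_thms)
  qed
  ultimately have iso: "companion_units \<tau> Mod scalars \<cong> mult_of (type_ring :: 'a ring)"
    using \<open>y \<noteq> 0\<close> by (intro quotient_iso_mult_group[of _ \<alpha> \<beta>]) auto
  interpret F: field "type_ring :: 'a ring"
    by (rule field_type_ring)
  have fin: "finite (carrier (type_ring :: 'a ring))"
    by (simp add: type_ring_def)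
  show "cyclic_group (companion_units \<tau> Mod scalars)"
    using isomorphic_group_cyclicity[OF iso group_companion_quotient F.field_mult_group]
      F.cyclic_mult_group[OF fin] by simp
  show "order (companion_units \<tau> Mod scalars) = CARD('a) - 1"
    using iso_same_card[OF iso] by (simp add: order_def type_ring_def card_Diff_singleton)
qed

section \<open>Reduction of rational numbers modulo a prime\<close>

lemma of_int_mod_ring_eq_0_iff:
  "(of_int n :: 'p::prime_card mod_ring) = 0 \<longleftrightarrow> int CARD('p) dvd n"
  using of_int_eq_iff_cong_CHAR[of n 0, where 'a = "'p mod_ring"] by (simp add: cong_0_iff)

text \<open>Reduction is computed from the fraction in lowest terms. The denominator in lowest terms divides
  any other one, so every fraction with denominator prime to \<open>p\<close> may be used instead; this is how
  the compatibility of reduction with the entries and the determinant of \<open>[a b]\<close> is checked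
  below.\<close>

lemma red_fraction:
  assumes "\<not> int CARD('p::prime_card) dvd n"
  shows "red (of_int m / of_int n) = (of_int m / of_int n :: 'p mod_ring)"
proof -
  obtain a b where q: "quotient_of (of_int m / of_int n) = (a, b)"
    by fastforce
  have "n \<noteq> 0"
    using assms by auto
  have "rat_of_int m / of_int n = of_int a / of_int b" and b: "b > 0"
    using q by (auto intro: quotient_of_div quotient_of_denom_pos)
  then have "rat_of_int (m * b) = of_int (a * n)"
    using \<open>n \<noteq> 0\<close> by (simp add: field_simps)
  then have eq: "m * b = a * n"
    by (simp only: of_int_eq_iff)
  have "coprime a b"
    using q by (rule quotient_of_coprime)
  moreover have "b dvd a * n"
    unfolding eq[symmetric] by simp
  ultimately have "b dvd n"
    by (metis coprime_commute coprime_dvd_mult_right_iff)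
  then have "\<not> int CARD('p) dvd b"
    using assms dvd_trans by blast
  then have nz: "(of_int b :: 'p mod_ring) \<noteq> 0" "(of_int n :: 'p mod_ring) \<noteq> 0"
    using assms by (simp_all only: of_int_mod_ring_eq_0_iff not_False_eq_True)
  have "(of_int m * of_int b :: 'p mod_ring) = of_int a * of_int n"
    using eq by (metis of_int_mult)
  then show ?thesis
    using nz by (simp add: red_def q field_simps)
qed

lemma red_of_int: "red (of_int m) = (of_int m :: 'p::prime_card mod_ring)"
proof -
  have "\<not> int CARD('p) dvd 1"
    using prime_card[where 'a='p] by (auto dest: prime_gt_1_nat)
  from red_fraction[OF this, of m] show ?thesis
    by simp
qed

section \<open>The sequence group modulo a prime\<close>

context
  fixes t :: rat
  assumes denominator: "\<not> int CARD('p::prime_card) dvd snd (quotient_of t)"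
begin

lemma red_as_fraction:
  obtains a b :: int where "t = of_int a / of_int b" "b \<noteq> 0" "\<not> int CARD('p) dvd b"
    "(of_int b :: 'p mod_ring) \<noteq> 0" "(red t :: 'p mod_ring) = of_int a / of_int b"
proof -
  obtain a b where q: "quotient_of t = (a, b)"
    by fastforce
  have p: "\<not> int CARD('p) dvd b"
    using denominator q by simp
  moreover have "t = of_int a / of_int b" "b \<noteq> 0"
    using quotient_of_div[OF q] quotient_of_denom_pos[OF q] by auto
  ultimately show thesis
    using that red_fraction[OF p, of a] of_int_mod_ring_eq_0_iff[of b, where 'p = 'p] by auto
qed

lemma red_discriminant: "(red (t\<^sup>2 - 4) :: 'p mod_ring) = (red t)\<^sup>2 - 4"
proof -
  obtain a b :: int where t: "t = of_int a / of_int b" and "b \<noteq> 0" and p: "\<not> int CARD('p) dvd b"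
    and b: "(of_int b :: 'p mod_ring) \<noteq> 0" and redt: "(red t :: 'p mod_ring) = of_int a / of_int b"
    by (rule red_as_fraction)
  have "\<not> int CARD('p) dvd b * b"
    using p prime_dvd_mult_iff[OF prime_card_int[where 'a='p]] by blast
  moreover have "t\<^sup>2 - 4 = of_int (a * a - 4 * (b * b)) / of_int (b * b)"
    using \<open>b \<noteq> 0\<close> by (simp add: t field_simps power2_eq_square)
  ultimately have "(red (t\<^sup>2 - 4) :: 'p mod_ring) = of_int (a * a - 4 * (b * b)) / of_int (b * b)"
    by (simp only: red_fraction not_False_eq_True)
  then show ?thesis
    using b by (simp add: redt field_simps power2_eq_square)
qed

lemma red_mat_seq_mat:
  "red_mat (seq_mat t (of_int m) (of_int n)) =
    companion_mat (red t :: 'p mod_ring) (of_int m) (of_int n)"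
proof -
  obtain a b :: int where t: "t = of_int a / of_int b" and "b \<noteq> 0" and p: "\<not> int CARD('p) dvd b"
    and b: "(of_int b :: 'p mod_ring) \<noteq> 0" and redt: "(red t :: 'p mod_ring) = of_int a / of_int b"
    by (rule red_as_fraction)
  have "rat_of_int n - t * of_int m = of_int (n * b - a * m) / of_int b"
    using \<open>b \<noteq> 0\<close> by (simp add: t field_simps)
  then have "(red (of_int n - t * of_int m) :: 'p mod_ring) = of_int (n * b - a * m) / of_int b"
    using p by (simp only: red_fraction not_False_eq_True)
  then have "(red (of_int n - t * of_int m) :: 'p mod_ring) = of_int n - red t * of_int m"
    using b by (simp add: redt field_simps)
  moreover have "(red (- of_int m) :: 'p mod_ring) = - of_int m"
    using red_of_int[of "- m"] by simp
  ultimately show ?thesis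
    by (simp add: vec_eq_iff forall_2 red_mat_def seq_mat_def companion_mat_def red_of_int)
qed

lemma red_det_seq_mat:
  "(red (det (seq_mat t (of_int m) (of_int n))) :: 'p mod_ring) =
    det (companion_mat (red t) (of_int m) (of_int n))"
proof -
  obtain a b :: int where t: "t = of_int a / of_int b" and "b \<noteq> 0" and p: "\<not> int CARD('p) dvd b"
    and b: "(of_int b :: 'p mod_ring) \<noteq> 0" and redt: "(red t :: 'p mod_ring) = of_int a / of_int b"
    by (rule red_as_fraction)
  have "det (seq_mat t (of_int m) (of_int n)) = of_int (n * n * b - a * m * n + m * m * b) / of_int b"
    using \<open>b \<noteq> 0\<close> by (simp add: t det_seq_mat field_simps power2_eq_square)
  then have "(red (det (seq_mat t (of_int m) (of_int n))) :: 'p mod_ring) =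
      of_int (n * n * b - a * m * n + m * m * b) / of_int b"
    using p by (simp only: red_fraction not_False_eq_True)
  then show ?thesis
    using b by (simp add: det_companion_mat redt field_simps power2_eq_square)
qed

text \<open>Reduced representatives differ only by a sign, which affects neither the coset modulo scalars
  nor the determinant.\<close>

lemma M_hom_eq_coset:
  assumes C: "C \<in> carrier (seq_group t)" and "is_reduced_rep t C (seq_mat t (of_int m) (of_int n))"
  shows "M_hom t C = scalars #>\<^bsub>GL2\<^esub> companion_mat (red t :: 'p mod_ring) (of_int m) (of_int n)"
    and "(red (det (reduced_rep t C)) :: 'p mod_ring) = det (companion_mat (red t) (of_int m) (of_int n))"
proof -
  have "is_reduced_rep t C (reduced_rep t C)"
    unfolding reduced_rep_def by (rule someI_ex[OF reduced_rep_exists[OF C]])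
  then have "reduced_rep t C = seq_mat t (of_int m) (of_int n) \<or>
      reduced_rep t C = - seq_mat t (of_int m) (of_int n)"
    using reduced_rep_unique[OF assms] by blast
  moreover have "- seq_mat t (of_int m) (of_int n) = seq_mat t (of_int (- m)) (of_int (- n))"
    by (simp add: seq_mat_def vec_eq_iff forall_2)
  ultimately obtain s :: int where s: "s = 1 \<or> s = - 1"
    and rep: "reduced_rep t C = seq_mat t (of_int (s * m)) (of_int (s * n))"
    by (metis mult_1 mult_minus1)
  have nz: "(of_int s :: 'p mod_ring) \<noteq> 0"
    using s by auto
  have "M_hom t C = scalars #>\<^bsub>GL2\<^esub> companion_mat (red t :: 'p mod_ring) (of_int (s * m)) (of_int (s * n))"
    by (simp only: M_hom_def rep red_mat_seq_mat)
  then show "M_hom t C = scalars #>\<^bsub>GL2\<^esub> companion_mat (red t :: 'p mod_ring) (of_int m) (of_int n)"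
    by (simp only: of_int_mult coset_scaled_companion_mat[OF nz])
  show "(red (det (reduced_rep t C)) :: 'p mod_ring) = det (companion_mat (red t) (of_int m) (of_int n))"
    unfolding rep red_det_seq_mat using s by (auto simp: det_companion_mat)
qed

text \<open>Any integer lift becomes coprime after division by its greatest common divisor, which is prime
  to \<open>p\<close> because the pair of residues is nonzero.\<close>

lemma coprime_lift:
  fixes x y :: "'p mod_ring"
  assumes "x \<noteq> 0 \<or> y \<noteq> 0"
  obtains c :: "'p mod_ring" and m n :: int
  where "c \<noteq> 0" "coprime m n" "x = c * of_int m" "y = c * of_int n"
proof -
  obtain k l :: int where k: "x = of_int k" and l: "y = of_int l"
    by (metis of_int_of_int_mod_ring of_int_mod_ring_to_int_mod_ring)
  have "k \<noteq> 0 \<or> l \<noteq> 0"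
    using assms k l by auto
  then obtain m n where kl: "k = gcd k l * m" "l = gcd k l * n" "coprime m n"
    using gcd_coprime_exists[of k l] by (metis gcd_eq_0_iff mult.commute)
  then have xy: "x = of_int (gcd k l) * of_int m" "y = of_int (gcd k l) * of_int n"
    unfolding k l by (metis of_int_mult)+
  then have "(of_int (gcd k l) :: 'p mod_ring) \<noteq> 0"
    using assms by auto
  then show thesis
    using kl(3) xy by (rule that)
qed

lemma image_M_hom:
  "M_hom t ` seq_group_tilde TYPE('p) t = carrier (companion_units (red t :: 'p mod_ring) Mod scalars)"
proof -
  let ?S = "companion_mat (red t :: 'p mod_ring)"
  have coset: "carrier (companion_units (red t :: 'p mod_ring) Mod scalars) =
      {scalars #>\<^bsub>GL2\<^esub> ?S x y | x y. det (?S x y) \<noteq> 0}"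
    by (auto simp: carrier_FactGroup r_coset_def GL2_def)
  show ?thesis
    unfolding coset
  proof (intro equalityI subsetI)
    fix Z :: "('p mod_ring^2^2) set" assume "Z \<in> M_hom t ` seq_group_tilde TYPE('p) t"
    then obtain C where C: "C \<in> carrier (seq_group t)"
      and det: "(red (det (reduced_rep t C)) :: 'p mod_ring) \<noteq> 0" and Z: "Z = M_hom t C"
      by (auto simp: seq_group_tilde_def)
    obtain m n :: int where "is_reduced_rep t C (seq_mat t (of_int m) (of_int n))"
      using reduced_rep_exists[OF C] unfolding is_reduced_rep_def by blast
    from M_hom_eq_coset[OF C this] det Z
    show "Z \<in> {scalars #>\<^bsub>GL2\<^esub> ?S x y | x y. det (?S x y) \<noteq> 0}"
      by auto
  next
    fix Z assume "Z \<in> {scalars #>\<^bsub>GL2\<^esub> ?S x y | x y. det (?S x y) \<noteq> 0}"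
    then obtain x y where Z: "Z = scalars #>\<^bsub>GL2\<^esub> ?S x y" and det: "det (?S x y) \<noteq> 0"
      by blast
    then have "x \<noteq> 0 \<or> y \<noteq> 0"
      by (auto simp: det_companion_mat)
    then obtain c m n where c: "c \<noteq> 0" and cop: "coprime m n"
      and xy: "x = c * of_int m" "y = c * of_int n"
      by (rule coprime_lift)
    have Z': "Z = scalars #>\<^bsub>GL2\<^esub> ?S (of_int m) (of_int n)"
      unfolding Z xy by (rule coset_scaled_companion_mat[OF c])
    have det': "det (?S (of_int m) (of_int n)) \<noteq> 0"
      using det unfolding xy companion_mat_scaled by (simp add: det_mul)
    let ?X = "seq_mat t (of_int m) (of_int n)"
    have "(red (det ?X) :: 'p mod_ring) \<noteq> 0"
      using det' by (simp only: red_det_seq_mat not_False_eq_True)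
    then have "det ?X \<noteq> 0"
      using red_of_int[of 0, where 'p = 'p] by auto
    define C where "C = scalars #>\<^bsub>R_units t\<^esub> ?X"
    have C: "C \<in> carrier (seq_group t)"
      using \<open>det ?X \<noteq> 0\<close>
      by (auto simp: C_def seq_group_def carrier_FactGroup R_units_def R_ring_eq)
    have "mat 1 \<in> (scalars :: (rat^2^2) set)"
      by (simp add: mat_in_scalars)
    then have "?X \<in> C"
      unfolding C_def r_coset_def by (force simp: R_units_def)
    then have "is_reduced_rep t C ?X"
      using cop unfolding is_reduced_rep_def by blast
    note rep = M_hom_eq_coset[OF C this]
    have "C \<in> seq_group_tilde TYPE('p) t"
      using C det' by (simp add: seq_group_tilde_def rep(2))
    then show "Z \<in> M_hom t ` seq_group_tilde TYPE('p) t"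
      unfolding Z' rep(1)[symmetric] by (rule imageI)
  qed
qed

text \<open>Cosets and products of cosets depend only on the matrix product, so quotienting inside the
  general linear group or inside the commutative subgroup gives the same structure.\<close>

lemma seq_group_mod_eq_quotient:
  "seq_group_mod TYPE('p) t = companion_units (red t :: 'p mod_ring) Mod scalars"
proof -
  have "set_mult GL2 = set_mult (companion_units (red t :: 'p mod_ring))"
    by (simp add: fun_eq_iff set_mult_def GL2_def)
  then show ?thesis
    using image_M_hom
    by (simp add: seq_group_mod_def PGL2_def FactGroup_def)
qed

end

theorem theorem16:
  fixes t :: rat and p :: nat
  assumes "t \<notin> {0, 1, -1, 2, -2}"
    and "p \<in> Pi_set t"
    and "CARD('p::prime_card) = p"
  shows "group (seq_group_mod TYPE('p) t) \<and>
    cyclic_group (seq_group_mod TYPE('p) t) \<and>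
    ((\<exists>y :: 'p mod_ring. y\<^sup>2 = red (t\<^sup>2 - 4)) \<longrightarrow>
      order (seq_group_mod TYPE('p) t) = p - 1) \<and>
    ((\<nexists>y :: 'p mod_ring. y\<^sup>2 = red (t\<^sup>2 - 4)) \<longrightarrow>
      order (seq_group_mod TYPE('p) t) = p + 1)"
proof -
  let ?\<tau> = "red t :: 'p mod_ring"
  have "odd p" and den: "\<not> int CARD('p) dvd snd (quotient_of t)"
    and num_\<delta>: "\<not> int CARD('p) dvd fst (quotient_of (t\<^sup>2 - 4))"
    and den_\<delta>: "\<not> int CARD('p) dvd snd (quotient_of (t\<^sup>2 - 4))"
    using assms by (auto simp: Pi_set_def)
  note eq = seq_group_mod_eq_quotient[OF den]
  have \<delta>: "(red (t\<^sup>2 - 4) :: 'p mod_ring) = ?\<tau>\<^sup>2 - 4"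
    by (rule red_discriminant[OF den])
  have "(red (t\<^sup>2 - 4) :: 'p mod_ring) \<noteq> 0"
    using num_\<delta> den_\<delta> by (simp add: red_def of_int_mod_ring_eq_0_iff)
  then have nz: "?\<tau>\<^sup>2 - 4 \<noteq> 0"
    by (simp only: \<delta> not_False_eq_True)
  have "\<not> int CARD('p) dvd 2"
  proof
    assume "int CARD('p) dvd 2"
    then have "p dvd 2"
      using assms(3) by (metis int_dvd_int_iff of_nat_numeral)
    then have "p = 2 \<or> p = 1"
      using prime_nat_iff two_is_prime_nat by blast
    then show False
      using \<open>odd p\<close> prime_card[where 'a='p] assms(3) by auto
  qed
  then have two: "(2 :: 'p mod_ring) \<noteq> 0"
    using of_int_mod_ring_eq_0_iff[of 2, where 'p='p] by simp
  show ?thesis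
  proof (cases "\<exists>y. y\<^sup>2 = ?\<tau>\<^sup>2 - 4")
    case True
    then obtain y where y: "y\<^sup>2 = ?\<tau>\<^sup>2 - 4"
      by blast
    show ?thesis
      using companion_quotient_square[OF y nz two] True group_companion_quotient assms(3)
      by (simp add: eq \<delta>)
  next
    case False
    then show ?thesis
      using companion_quotient_nonsquare[OF False] group_companion_quotient assms(3)
      by (simp add: eq \<delta>)
  qed
qed

end
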